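(* Let $L$ be a (nonempty) oriented closed link diagram and $\boldsymbol{\ell}$ a labeling of its strands by elements of $\mathsf{P}'$. Then $Q^{\boldsymbol{\ell}}(L)=0$, where $Q^{\boldsymbol{\ell}}(L)\in\mathrm{End}_{U_q}(\mathbb{C}(q))=\mathbb{C}(q)$ is the $U_q(\mathfrak{gl}(1|1))$-invariant of $L$ viewed as an oriented framed tangle (blackboard framing) with no source and no target points.
   Context: Superobjects are $\mathbb{Z}/2\mathbb{Z}$-graded with $|x|$ the degree of $x$; $(a\otimes b)(c\otimes d)=(-1)^{|b||c|}ac\otimes bd$ and $(a\otimes b)(m\otimes n)=(-1)^{|b||m|}am\otimes bn$. Let $\mathsf{P}^*=\mathbb{Z}h_1\oplus\mathbb{Z}h_2$, $\mathsf{P}=\mathbb{Z}\epsilon_1\oplus\mathbb{Z}\epsilon_2$ its dual lattice (dual bases), $\alpha=\epsilon_1-\epsilon_2$, with symmetric bilinear form on $\mathsf{P}$: $(\epsilon_1,\epsilon_1)=1$, $(\epsilon_2,\epsilon_2)=-1$, $(\epsilon_1,\epsilon_2)=0$, and parity $|\epsilon_1|=0$, $|\epsilon_2|=1$ extended additively to $\mathsf{P}\to\mathbb{Z}/2$. $U_q=U_q(\mathfrak{gl}(1|1))$ is the $\mathbb{C}(q)$-superalgebra generated by odd $E,F$ and even $\boldsymbol{\mathrm{q}}^h$ ($h\in\mathsf{P}^*$) with $\boldsymbol{\mathrm{q}}^0=1$, $\boldsymbol{\mathrm{q}}^h\boldsymbol{\mathrm{q}}^{h'}=\boldsymbol{\mathrm{q}}^{h+h'}$,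 $\boldsymbol{\mathrm{q}}^hE=q^{\langle h,\alpha\rangle}E\boldsymbol{\mathrm{q}}^h$, $\boldsymbol{\mathrm{q}}^hF=q^{-\langle h,\alpha\rangle}F\boldsymbol{\mathrm{q}}^h$, $EF+FE=\frac{K-K^{-1}}{q-q^{-1}}$ with $K=\boldsymbol{\mathrm{q}}^{h_1+h_2}$, $E^2=F^2=0$. Hopf structure: $\Delta(E)=E\otimes K^{-1}+1\otimes E$, $\Delta(F)=F\otimes1+K\otimes F$, $\Delta(\boldsymbol{\mathrm{q}}^h)=\boldsymbol{\mathrm{q}}^h\otimes\boldsymbol{\mathrm{q}}^h$, $S(E)=-EK$, $S(F)=-K^{-1}F$, $S(\boldsymbol{\mathrm{q}}^h)=\boldsymbol{\mathrm{q}}^{-h}$, counit $0$ on $E,F$ and $1$ on $\boldsymbol{\mathrm{q}}^h$. A representation is a finite-dimensional $U_q$-supermodule $M=\bigoplus_{\lambda\in\mathsf{P}}M_\lambda$ with $\boldsymbol{\mathrm{q}}^h$ acting by $q^{\langle h,\lambda\rangle}$ on $M_\lambda$ and $M_\lambda$ in degree $|\lambda|$. $U_q$ acts on tensor products via $\Delta$ and on the dual $M^*$ by $(x\varphi)(m)=(-1)^{|\varphi||x|}\varphi(S(x)m)$; $\mathbb{C}(q)$ denotes also the trivial representation. $\mathsf{P}'=\{\lambda\in\mathsf{P}:\langle h_1+h_2,\lambda\rangle\ne0\}$. For $\lambda\in\mathsf{P}'$, $L(\lambda)$ is the simple representation with basis $v_0^\lambda,v_1^\lambda$ of weights $\lambda,\lambda-\alpha$,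 with $Ev_0^\lambda=0$, $Fv_0^\lambda=[\lambda]v_1^\lambda$, $Ev_1^\lambda=v_0^\lambda$, $Fv_1^\lambda=0$, where $[\lambda]=\frac{q^k-q^{-k}}{q-q^{-1}}$, $k=\langle h_1+h_2,\lambda\rangle$. For representations $V,W$: $\Upsilon_{V,W}$ acts on $v\otimes w$ with $v,w$ of weights $\lambda,\mu$ by $q^{(\lambda,\mu)}$; $\Theta=1+(q-q^{-1})F\otimes E$; $\check R_{V,W}=\sigma\circ\Theta\Upsilon_{V,W}:V\otimes W\to W\otimes V$, $\sigma(v\otimes w)=(-1)^{|v||w|}w\otimes v$; this is a $U_q$-equivariant isomorphism. The ribbon operator $v_V$ is $v_V(w)=q^{-(\mu,\mu)}(K^{-1}+(q-q^{-1})EF)w$ for $w$ of weight $\mu$, and $u_V=Kv_V$; thus $uv^{-1}$ acts as $K$ and $vu^{-1}$ as $K^{-1}$. Further $\mathrm{ev}:V^*\otimes V\to\mathbb{C}(q)$, $\varphi\otimes w\mapsto\varphi(w)$; $\widehat{\mathrm{ev}}:V\otimes V^*\to\mathbb{C}(q)$, $w\otimes\varphi\mapsto(-1)^{|\varphi||w|}\varphi(w)$; $\mathrm{coev}:1\mapsto\sum_iw_i\otimes w_i^*\in V\otimes V^*$; $\widehat{\mathrm{coev}}:1\mapsto\sum_i(-1)^{|w_i|}w_i^*\otimes w_i\in V^*\otimes V$ ($w_i$ a homogeneous basis). For an oriented tangle diagram $D\subset\mathbb{R}\times[0,1]$ with strands labeled by elements $\lambda\in\mathsf{P}'$ (i.e.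 by the representations $L(\lambda)$), $Q^{\boldsymbol{\ell}}(D)$ is the $U_q$-equivariant map, from the tensor product over source points (on $\mathbb{R}\times0$, left to right) to the tensor product over target points (on $\mathbb{R}\times1$) of $L(\lambda)$ (strand upward) or $L(\lambda)^*$ (strand downward), defined by decomposing $D$ (after planar isotopy) into elementary pieces read from bottom to top, composing vertically and tensoring horizontally, with: upward strand labeled $V$ $\mapsto\mathrm{id}_V$; downward strand $\mapsto\mathrm{id}_{V^*}$; crossing of two upward strands, $V$ at bottom left and $W$ at bottom right, $\mapsto\check R_{V,W}$ if the strand from bottom left to top right passes over, and $\mapsto\check R^{-1}=(\check R_{W,V})^{-1}:V\otimes W\to W\otimes V$ if it passes under; cap oriented left to right $\mapsto\widehat{\mathrm{ev}}\circ(uv^{-1}\otimes\mathrm{id}):V\otimes V^*\to\mathbb{C}(q)$; cap oriented right to left $\mapsto\mathrm{ev}:V^*\otimes V\to\mathbb{C}(q)$; cup oriented left to right $\mapsto(\mathrm{id}\otimes vu^{-1})\circ\widehat{\mathrm{coev}}:\mathbb{C}(q)\to V^*\otimes V$; cup oriented right to left $\mapsto\mathrm{coev}:\mathbb{C}(q)\to V\otimes V^*$. The result is an isotopy invariant of labeled oriented framed tangles (blackboard framing). *)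

theory Defs
  imports "HOL-Analysis.Analysis" "HOL-Computational_Algebra.Fraction_Field"
begin

section \<open>The ground field \<open>\<complex>(q)\<close> and the weight lattice\<close>

type_synonym cq = "complex poly fract"

definition q :: cq where
  "q = Fract [:0, 1:] 1"

text \<open>A pair \<open>(a, b)\<close> stands for \<open>a \<epsilon>\<^sub>1 + b \<epsilon>\<^sub>2\<close> in \<open>P\<close>, respectively
  for \<open>a h\<^sub>1 + b h\<^sub>2\<close> in the dual lattice \<open>P\<^sup>*\<close>.\<close>

type_synonym weight = "int \<times> int"
type_synonym coweight = "int \<times> int"

definition pairing :: "coweight \<Rightarrow> weight \<Rightarrow> int" where
  "pairing h l = fst h * fst l + snd h * snd l"

definition form :: "weight \<Rightarrow> weight \<Rightarrow> int" where
  "form l m = fst l * fst m - snd l * snd m"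

definition parity :: "weight \<Rightarrow> nat" where
  "parity l = nat (snd l mod 2)"

definition \<alpha> :: weight where
  "\<alpha> = (1, -1)"

definition P' :: "weight set" where
  "P' = {l. pairing (1, 1) l \<noteq> 0}"

section \<open>Representations of \<open>U\<^sub>q(gl(1|1))\<close>\<close>

text \<open>A representation is given in a basis of weight vectors, indexed by a finite type.
  A linear map is the matrix of its coefficients, \<open>A $ i $ j\<close> being the coefficient of the
  \<open>i\<close>-th basis vector in the image of the \<open>j\<close>-th one; the basis of \<open>V \<otimes> W\<close> is indexed by pairs.
  The weights determine both the action of \<open>\<^bold>q\<^sup>h\<close> and the degrees.\<close>

record 'b rep =
  wt :: "'b \<Rightarrow> weight"
  actE :: "cq^'b^'b"
  actF :: "cq^'b^'b"

definition deg :: "('b::finite) rep \<Rightarrow> 'b \<Rightarrow> nat" where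
  "deg V i = parity (wt V i)"

definition diag :: "('b \<Rightarrow> cq) \<Rightarrow> cq^'b^('b::finite)" where
  "diag f = (\<chi> i j. if i = j then f i else 0)"

definition actq :: "('b::finite) rep \<Rightarrow> coweight \<Rightarrow> cq^'b^'b" where
  "actq V h = diag (\<lambda>i. q powi pairing h (wt V i))"

definition actK :: "('b::finite) rep \<Rightarrow> cq^'b^'b" where
  "actK V = actq V (1, 1)"

definition actKinv :: "('b::finite) rep \<Rightarrow> cq^'b^'b" where
  "actKinv V = actq V (-1, -1)"

text \<open>The defining relations of \<open>U\<^sub>q\<close>; those among the \<open>\<^bold>q\<^sup>h\<close> hold by construction. As
  \<open>\<alpha>\<close> is odd, the commutation with \<open>\<^bold>q\<^sup>h\<close> also makes \<open>E\<close> and \<open>F\<close> odd operators.\<close>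

definition is_representation :: "('b::finite) rep \<Rightarrow> bool" where
  "is_representation V \<longleftrightarrow>
    (\<forall>h. actq V h ** actE V = mat (q powi pairing h \<alpha>) ** actE V ** actq V h) \<and>
    (\<forall>h. actq V h ** actF V = mat (q powi (- pairing h \<alpha>)) ** actF V ** actq V h) \<and>
    actE V ** actF V + actF V ** actE V
      = mat (inverse (q - inverse q)) ** (actK V - actKinv V) \<and>
    actE V ** actE V = 0 \<and> actF V ** actF V = 0"

text \<open>The dual representation in the dual basis, from
  \<open>(x \<phi>)(m) = (-1)\<^bsup>|\<phi>||x|\<^esup> \<phi>(S(x) m)\<close> with \<open>S(E) = - E K\<close> and \<open>S(F) = - K\<^sup>-\<^sup>1 F\<close>.\<close>

definition dual_rep :: "('b::finite) rep \<Rightarrow> 'b rep" where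
  "dual_rep V =
    \<lparr> wt = (\<lambda>i. - wt V i),
      actE = (\<chi> i j. (-1) ^ deg V j * (- (actE V ** actK V)) $ j $ i),
      actF = (\<chi> i j. (-1) ^ deg V j * (- (actKinv V ** actF V)) $ j $ i) \<rparr>"

datatype basis = V0 | V1

instance basis :: finite
proof
  have "(UNIV :: basis set) = {V0, V1}"
    by (auto intro: basis.exhaust)
  then show "finite (UNIV :: basis set)"
    by (metis finite.emptyI finite.insertI)
qed

definition qbracket :: "weight \<Rightarrow> cq" where
  "qbracket l = (q powi pairing (1, 1) l - q powi (- pairing (1, 1) l)) / (q - inverse q)"

definition L :: "weight \<Rightarrow> basis rep" where
  "L l =
    \<lparr> wt = (\<lambda>i. case i of V0 \<Rightarrow> l | V1 \<Rightarrow> l - \<alpha>),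
      actE = (\<chi> i j. if i = V0 \<and> j = V1 then 1 else 0),
      actF = (\<chi> i j. if i = V1 \<and> j = V0 then qbracket l else 0) \<rparr>"

lemma UNIV_basis: "(UNIV :: basis set) = {V0, V1}"
  by (auto intro: basis.exhaust)

lemma q_nonzero: "q \<noteq> 0"
  by (simp add: q_def Zero_fract_def eq_fract)

lemma basis_all: "(\<forall>i. P i) \<longleftrightarrow> P V0 \<and> P V1"
  by (metis basis.exhaust)

lemma is_representation_L: "is_representation (L l)"
proof -
  have cancel: "q * (inverse q * x) = x" for x
    using q_nonzero by (simp flip: mult.assoc)
  show ?thesis
    unfolding is_representation_def using q_nonzero
    by (auto simp: vec_eq_iff matrix_matrix_mult_def mat_def actq_def actK_def actKinv_def
        diag_def L_def UNIV_basis basis_all pairing_def \<alpha>_def qbracket_def power_int_add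
        power_int_diff power_int_minus divide_inverse algebra_simps cancel)
      (simp add: field_simps)
qed

section \<open>Braiding, ribbon element, evaluations and coevaluations\<close>

text \<open>\<open>(a \<otimes> b)(m \<otimes> n) = (-1)\<^bsup>|b||m|\<^esup> a m \<otimes> b n\<close> for \<open>m\<close> in \<open>V\<close>; the argument \<open>d\<close> is \<open>|b|\<close>.\<close>

definition tensor_op ::
    "('v::finite) rep \<Rightarrow> cq^'v^'v \<Rightarrow> nat \<Rightarrow> cq^'w^'w \<Rightarrow> cq^('v \<times> 'w)^('v \<times> ('w::finite))" where
  "tensor_op V a d b = (\<chi> x y. (-1) ^ (d * deg V (fst y)) * a $ fst x $ fst y * b $ snd x $ snd y)"

definition Upsilon :: "('v::finite) rep \<Rightarrow> ('w::finite) rep \<Rightarrow> cq^('v \<times> 'w)^('v \<times> 'w)" where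
  "Upsilon V W = diag (\<lambda>x. q powi form (wt V (fst x)) (wt W (snd x)))"

definition Theta :: "('v::finite) rep \<Rightarrow> ('w::finite) rep \<Rightarrow> cq^('v \<times> 'w)^('v \<times> 'w)" where
  "Theta V W = mat 1 + mat (q - inverse q) ** tensor_op V (actF V) 1 (actE W)"

definition super_flip :: "('v::finite) rep \<Rightarrow> ('w::finite) rep \<Rightarrow> cq^('v \<times> 'w)^('w \<times> 'v)" where
  "super_flip V W =
    (\<chi> x y. if x = (snd y, fst y) then (-1) ^ (deg V (fst y) * deg W (snd y)) else 0)"

definition Rcheck :: "('v::finite) rep \<Rightarrow> ('w::finite) rep \<Rightarrow> cq^('v \<times> 'w)^('w \<times> 'v)" where
  "Rcheck V W = super_flip V W ** (Theta V W ** Upsilon V W)"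

definition ribbon_v :: "('v::finite) rep \<Rightarrow> cq^'v^'v" where
  "ribbon_v V = (actKinv V + mat (q - inverse q) ** (actE V ** actF V))
     ** diag (\<lambda>i. q powi (- form (wt V i) (wt V i)))"

definition ribbon_u :: "('v::finite) rep \<Rightarrow> cq^'v^'v" where
  "ribbon_u V = actK V ** ribbon_v V"

text \<open>In the following four maps the basis of \<open>V\<^sup>*\<close> is the dual basis, indexed like that of \<open>V\<close>,
  and the basis of \<open>\<complex>(q)\<close> is indexed by \<open>()\<close>.\<close>

definition ev :: "('v::finite) rep \<Rightarrow> cq^('v \<times> 'v)^unit" where
  "ev V = (\<chi> _ y. if fst y = snd y then 1 else 0)"

definition ev_hat :: "('v::finite) rep \<Rightarrow> cq^('v \<times> 'v)^unit" where
  "ev_hat V = (\<chi> _ y. (-1) ^ (deg (dual_rep V) (snd y) * deg V (fst y)) *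
    (if fst y = snd y then 1 else 0))"

definition coev :: "('v::finite) rep \<Rightarrow> cq^unit^('v \<times> 'v)" where
  "coev V = (\<chi> x _. if fst x = snd x then 1 else 0)"

definition coev_hat :: "('v::finite) rep \<Rightarrow> cq^unit^('v \<times> 'v)" where
  "coev_hat V = (\<chi> x _. if fst x = snd x then (-1) ^ deg V (snd x) else 0)"

section \<open>Labeled oriented tangle diagrams\<close>

text \<open>A diagram in \<open>\<real> \<times> [0,1]\<close> is given by its decomposition into horizontal layers, listed from
  bottom to top; each layer is the list, from left to right, of its elementary pieces. All
  crossings are between upward strands, as every diagram can be arranged to be by planar isotopy.
  The label of a strand is recorded at every piece that the strand meets. For a crossing, the
  labels are those at the bottom left and at the bottom right, and \<open>CrossOver\<close>
  (\<open>CrossUnder\<close>) means that the strand from bottom left to top right passes over (under).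
  \<open>LR\<close> and \<open>RL\<close> are the orientations left to right and right to left.\<close>

datatype 'l piece =
    UpStrand 'l
  | DownStrand 'l
  | CrossOver 'l 'l
  | CrossUnder 'l 'l
  | CapLR 'l
  | CapRL 'l
  | CupLR 'l
  | CupRL 'l

datatype orientation = Up | Down

type_synonym 'l layer = "'l piece list"
type_synonym 'l diagram = "'l layer list"

fun piece_source :: "'l piece \<Rightarrow> (orientation \<times> 'l) list" where
  "piece_source (UpStrand l) = [(Up, l)]"
| "piece_source (DownStrand l) = [(Down, l)]"
| "piece_source (CrossOver l m) = [(Up, l), (Up, m)]"
| "piece_source (CrossUnder l m) = [(Up, l), (Up, m)]"
| "piece_source (CapLR l) = [(Up, l), (Down, l)]"
| "piece_source (CapRL l) = [(Down, l), (Up, l)]"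
| "piece_source (CupLR l) = []"
| "piece_source (CupRL l) = []"

fun piece_target :: "'l piece \<Rightarrow> (orientation \<times> 'l) list" where
  "piece_target (UpStrand l) = [(Up, l)]"
| "piece_target (DownStrand l) = [(Down, l)]"
| "piece_target (CrossOver l m) = [(Up, m), (Up, l)]"
| "piece_target (CrossUnder l m) = [(Up, m), (Up, l)]"
| "piece_target (CapLR l) = []"
| "piece_target (CapRL l) = []"
| "piece_target (CupLR l) = [(Down, l), (Up, l)]"
| "piece_target (CupRL l) = [(Up, l), (Down, l)]"

definition layer_source :: "'l layer \<Rightarrow> (orientation \<times> 'l) list" where
  "layer_source ps = concat (map piece_source ps)"

definition layer_target :: "'l layer \<Rightarrow> (orientation \<times> 'l) list" where
  "layer_target ps = concat (map piece_target ps)"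

text \<open>\<open>is_tangle s D t\<close>: the layers of \<open>D\<close> fit together, with matching orientations and labels, to
  a labeled oriented tangle diagram with source \<open>s\<close> and target \<open>t\<close>.\<close>

fun is_tangle :: "(orientation \<times> 'l) list \<Rightarrow> 'l diagram \<Rightarrow> (orientation \<times> 'l) list \<Rightarrow> bool" where
  "is_tangle s [] t \<longleftrightarrow> s = t"
| "is_tangle s (ps # D) t \<longleftrightarrow> layer_source ps = s \<and> is_tangle (layer_target ps) D t"

definition is_link :: "'l diagram \<Rightarrow> bool" where
  "is_link D \<longleftrightarrow> is_tangle [] D []"

definition pieces :: "'l diagram \<Rightarrow> 'l piece set" where
  "pieces D = (\<Union>ps\<in>set D. set ps)"

definition labels :: "'l diagram \<Rightarrow> 'l set" where
  "labels D = (\<Union>p\<in>pieces D. set_piece p)"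

section \<open>The invariant \<open>Q\<close>\<close>

text \<open>The tensor product over a boundary with \<open>n\<close> points has its basis indexed by the lists in
  \<open>basis\<close> of length \<open>n\<close>. Linear maps between these spaces are given by their coefficients, with
  the target index first. All elementary maps are even, so that tensoring maps
  horizontally produces no signs.\<close>

definition Q_piece :: "weight piece \<Rightarrow> basis list \<Rightarrow> basis list \<Rightarrow> cq" where
  "Q_piece p ys xs = (case p of
      UpStrand l \<Rightarrow> (mat 1 :: cq^basis^basis) $ (ys ! 0) $ (xs ! 0)
    | DownStrand l \<Rightarrow> (mat 1 :: cq^basis^basis) $ (ys ! 0) $ (xs ! 0)
    | CrossOver l m \<Rightarrow> Rcheck (L l) (L m) $ (ys ! 0, ys ! 1) $ (xs ! 0, xs ! 1)
    | CrossUnder l m \<Rightarrow> matrix_inv (Rcheck (L m) (L l)) $ (ys ! 0, ys ! 1) $ (xs ! 0, xs ! 1)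
    | CapLR l \<Rightarrow>
        (ev_hat (L l) ** tensor_op (L l) (ribbon_u (L l) ** matrix_inv (ribbon_v (L l))) 0 (mat 1))
          $ () $ (xs ! 0, xs ! 1)
    | CapRL l \<Rightarrow> ev (L l) $ () $ (xs ! 0, xs ! 1)
    | CupLR l \<Rightarrow>
        (tensor_op (dual_rep (L l)) (mat 1) 0 (ribbon_v (L l) ** matrix_inv (ribbon_u (L l)))
          ** coev_hat (L l)) $ (ys ! 0, ys ! 1) $ ()
    | CupRL l \<Rightarrow> coev (L l) $ (ys ! 0, ys ! 1) $ ())"

fun Q_layer :: "weight layer \<Rightarrow> basis list \<Rightarrow> basis list \<Rightarrow> cq" where
  "Q_layer [] ys xs = (if ys = [] \<and> xs = [] then 1 else 0)"
| "Q_layer (p # ps) ys xs =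
    (let m = length (piece_target p); n = length (piece_source p)
     in Q_piece p (take m ys) (take n xs) * Q_layer ps (drop m ys) (drop n xs))"

fun Q :: "weight diagram \<Rightarrow> basis list \<Rightarrow> basis list \<Rightarrow> cq" where
  "Q [] ys xs = (if ys = xs then 1 else 0)"
| "Q (ps # D) ys xs =
    (\<Sum>zs | length zs = length (layer_target ps). Q D ys zs * Q_layer ps zs xs)"

text \<open>For a link both boundary spaces are \<open>\<complex>(q)\<close>, with the empty list as the only basis index.\<close>

definition Q_link :: "weight diagram \<Rightarrow> cq" where
  "Q_link D = Q D [] []"

end

theory Submission
  imports Defs
begin

text \<open>Only the action of \<open>E\<close> is needed. Every elementary piece commutes with \<open>E\<close>, so the part of a
  link diagram above a given height is a functional \<open>f\<close> with \<open>f \<circ> E = 0\<close>, because \<open>E\<close> acts by zero on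
  the trivial representation. On the other hand the lowest piece of a nonempty link diagram is a
  cup, and the image of \<open>1\<close> under a cup lies in the image of \<open>E\<close>. Hence the invariant vanishes.\<close>

section \<open>The action of \<open>E\<close> on a tensor product of strands\<close>

fun strand_rep :: "orientation \<times> weight \<Rightarrow> basis rep" where
  "strand_rep (Up, l) = L l"
| "strand_rep (Down, l) = dual_rep (L l)"

fun K_weight :: "orientation \<times> weight \<Rightarrow> int" where
  "K_weight (Up, l) = pairing (1, 1) l"
| "K_weight (Down, l) = - pairing (1, 1) l"

fun Kinv_scalar :: "(orientation \<times> weight) list \<Rightarrow> cq" where
  "Kinv_scalar [] = 1"
| "Kinv_scalar (a # s) = q powi (- K_weight a) * Kinv_scalar s"

text \<open>The parity operator of the tensor product. It enters because
  \<open>1 \<otimes> E\<close> with \<open>E\<close> odd produces the sign \<open>(-1)^|m|\<close>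
  on passing a factor \<open>m\<close> to its left.\<close>

fun tensor_sign :: "(orientation \<times> weight) list \<Rightarrow> basis list \<Rightarrow> cq" where
  "tensor_sign [] xs = 1"
| "tensor_sign (a # s) xs = (-1) ^ deg (strand_rep a) (hd xs) * tensor_sign s (tl xs)"

text \<open>The matrix of \<open>E\<close> on a tensor product, from \<open>\<Delta>(E) = E \<otimes> K\<^sup>-\<^sup>1 + 1 \<otimes> E\<close>. As
  \<open>\<langle>h\<^sub>1 + h\<^sub>2, \<alpha>\<rangle> = 0\<close>, \<open>K\<^sup>-\<^sup>1\<close> acts by a scalar.\<close>

fun tensor_E :: "(orientation \<times> weight) list \<Rightarrow> basis list \<Rightarrow> basis list \<Rightarrow> cq" where
  "tensor_E [] ys xs = 0"
| "tensor_E (a # s) ys xs =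
    actE (strand_rep a) $ hd ys $ hd xs * (if tl ys = tl xs then Kinv_scalar s else 0)
    + (if hd ys = hd xs then (-1) ^ deg (strand_rep a) (hd xs) * tensor_E s (tl ys) (tl xs) else 0)"

lemma sum_lists_append:
  fixes h :: "'a::finite list \<Rightarrow> 'b::comm_monoid_add"
  shows "(\<Sum>zs | length zs = m + n. h zs) =
    (\<Sum>xs | length xs = m. \<Sum>ys | length ys = n. h (xs @ ys))"
proof -
  have "(\<Sum>xs | length xs = m. \<Sum>ys | length ys = n. h (xs @ ys))
    = (\<Sum>(xs, ys) \<in> {xs. length xs = m} \<times> {ys. length ys = n}. h (xs @ ys))"
    by (rule sum.cartesian_product)
  also have "\<dots> = (\<Sum>zs | length zs = m + n. h zs)"
    by (rule sum.reindex_bij_witness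
        [of _ "\<lambda>zs. (take m zs, drop m zs)" "\<lambda>(xs, ys). xs @ ys"]) auto
  finally show ?thesis ..
qed

lemma finite_lists_length: "finite {zs :: 'a::finite list. length zs = n}"
  using finite_lists_length_eq[of "UNIV :: 'a set" n] by simp

lemma sum_lists_1:
  fixes h :: "'a::finite list \<Rightarrow> 'b::comm_monoid_add"
  shows "(\<Sum>zs | length zs = Suc 0. h zs) = (\<Sum>a\<in>UNIV. h [a])"
  by (rule sum.reindex_bij_witness[of _ "\<lambda>a. [a]" hd]) (auto simp: length_Suc_conv)

lemma sum_lists_2:
  fixes h :: "'a::finite list \<Rightarrow> 'b::comm_monoid_add"
  shows "(\<Sum>zs | length zs = Suc (Suc 0). h zs) = (\<Sum>p\<in>UNIV. h [fst p, snd p])"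
  by (rule sum.reindex_bij_witness[of _ "\<lambda>p. [fst p, snd p]" "\<lambda>zs. (zs ! 0, zs ! 1)"])
    (auto simp: length_Suc_conv)

lemma Kinv_scalar_append: "Kinv_scalar (s @ t) = Kinv_scalar s * Kinv_scalar t"
  by (induction s) auto

lemma tensor_sign_append:
  "length xs = length s \<Longrightarrow> tensor_sign (s @ t) (xs @ xs') = tensor_sign s xs * tensor_sign t xs'"
  by (induction s arbitrary: xs) (auto simp: length_Suc_conv)

text \<open>Coassociativity: the recursion of \<open>tensor_E\<close> splits off one factor, and
  this gives \<Delta>(E) for a cut at any place. The odd \<open>E\<close> passes the whole first
  block, hence \<open>tensor_sign s\<close>.\<close>

lemma tensor_E_append:
  assumes "length ys = length s" "length xs = length s"
  shows "tensor_E (s @ t) (ys @ ys') (xs @ xs') =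
    tensor_E s ys xs * (if ys' = xs' then Kinv_scalar t else 0)
    + (if ys = xs then tensor_sign s xs * tensor_E t ys' xs' else 0)"
  using assms
proof (induction s arbitrary: ys xs)
  case Nil
  then show ?case by simp
next
  case (Cons a s)
  obtain y ys1 where y: "ys = y # ys1" "length ys1 = length s"
    using Cons.prems by (cases ys) auto
  obtain x xs1 where x: "xs = x # xs1" "length xs1 = length s"
    using Cons.prems by (cases xs) auto
  show ?case
    using Cons.IH[OF y(2) x(2)] y x by (auto simp: Kinv_scalar_append algebra_simps)
qed

section \<open>Matrix coefficients on \<open>L l\<close> and of the braiding\<close>

lemma q_minus_inverse_nonzero: "q - inverse q \<noteq> 0"
proof
  assume "q - inverse q = 0"
  then have "q * q = 1"
    using q_nonzero by (simp add: field_simps)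
  then show False
    by (simp add: q_def One_fract_def eq_fract one_pCons)
qed

lemma parity_eq: "parity l = (if even (snd l) then 0 else 1)"
  by (auto simp: parity_def even_iff_mod_2_eq_zero odd_iff_mod_2_eq_one)

lemma mult_diag_nth: "(A ** diag f) $ x $ y = A $ x $ y * f y"
  by (simp add: matrix_matrix_mult_def diag_def if_distrib cong: if_cong)

lemma diag_mult_nth: "(diag f ** A) $ x $ y = f x * A $ x $ y"
  by (simp add: matrix_matrix_mult_def diag_def if_distrib if_distribR cong: if_cong)

lemma diag_mult: "diag f ** diag g = diag (\<lambda>i. f i * g i)"
  by (simp add: vec_eq_iff mult_diag_nth) (simp add: diag_def)

lemma Rcheck_nth:
  "Rcheck V W $ x $ y =
    (-1) ^ (deg V (snd x) * deg W (fst x)) *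
    ((if (snd x, fst x) = y then 1 else 0)
      + (q - inverse q) * ((-1) ^ deg V (fst y) * actF V $ snd x $ fst y * actE W $ fst x $ snd y)) *
    q powi form (wt V (fst y)) (wt W (snd y))"
proof -
  have flip: "(super_flip V W ** A) $ x $ y =
      (-1) ^ (deg V (snd x) * deg W (fst x)) * A $ (snd x, fst x) $ y" for A
  proof -
    have "super_flip V W $ x $ k * A $ k $ y = (if k = (snd x, fst x) then
        (-1) ^ (deg V (snd x) * deg W (fst x)) * A $ k $ y else 0)" for k
      by (cases x; cases k) (auto simp: super_flip_def)
    then show ?thesis
      by (simp add: matrix_matrix_mult_def)
  qed
  have mt: "(mat c ** A) $ x $ y = c * A $ x $ y" for A :: "cq^'c^'d" and c x y
    by (simp add: matrix_matrix_mult_def mat_def if_distrib if_distribR cong: if_cong)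
  show ?thesis
    unfolding Rcheck_def flip Upsilon_def mult_diag_nth Theta_def vector_add_component mt tensor_op_def
    by (simp add: mat_def)
qed

lemma sum_basis: "(\<Sum>i\<in>UNIV. f i) = f V0 + f V1"
  by (simp add: UNIV_basis)

lemma UNIV_basis_pair: "UNIV = {(V0, V0), (V0, V1), (V1, V0), (V1, V1)}"
  by (auto, (metis basis.exhaust)+)

lemma sum_basis_pair: "(\<Sum>i\<in>UNIV. f i) = f (V0,V0) + f (V0,V1) + f (V1,V0) + f (V1,V1)"
  unfolding UNIV_basis_pair by (simp add: add.assoc)

lemma L_simps:
  "wt (L l) V0 = l" "wt (L l) V1 = l - \<alpha>"
  "actE (L l) $ i $ j = (if i = V0 \<and> j = V1 then 1 else 0)"
  "actF (L l) $ i $ j = (if i = V1 \<and> j = V0 then qbracket l else 0)"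
  by (simp_all add: L_def)

lemma deg_L: "deg (L l) V0 = (if even (snd l) then 0 else 1)"
  "deg (L l) V1 = (if even (snd l) then 1 else 0)"
  by (simp_all add: deg_def L_simps parity_eq \<alpha>_def)

text \<open>The factor \<open>q - inverse q\<close> of \<open>Theta\<close> cancels the denominator
  of the bracket, so the braiding can be computed without dividing by it.\<close>

lemma qbracket_mult: "(q - inverse q) * qbracket l =
    q powi pairing (1, 1) l - inverse (q powi pairing (1, 1) l)"
  using q_minus_inverse_nonzero by (simp add: qbracket_def power_int_minus)

text \<open>The form of \<open>l\<close> with \<alpha> is \<open>pairing (1, 1) l\<close>, and
  \<alpha> is isotropic; the rest is bilinearity.\<close>

lemma q_powi_form:
  "q powi form l (m - \<alpha>) = q powi form l m / q powi pairing (1, 1) l"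
  "q powi form (l - \<alpha>) m = q powi form l m / q powi pairing (1, 1) m"
  "q powi form (l - \<alpha>) (m - \<alpha>) = q powi form l m / (q powi pairing (1, 1) l * q powi pairing (1, 1) m)"
proof -
  have "form l (m - \<alpha>) = form l m - pairing (1, 1) l"
    "form (l - \<alpha>) m = form l m - pairing (1, 1) m"
    "form (l - \<alpha>) (m - \<alpha>) = form l m - (pairing (1, 1) l + pairing (1, 1) m)"
    by (simp_all add: form_def pairing_def \<alpha>_def algebra_simps)
  then show "q powi form l (m - \<alpha>) = q powi form l m / q powi pairing (1, 1) l"
    "q powi form (l - \<alpha>) m = q powi form l m / q powi pairing (1, 1) m"
    "q powi form (l - \<alpha>) (m - \<alpha>) = q powi form l m / (q powi pairing (1, 1) l * q powi pairing (1, 1) m)"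
    using q_nonzero by (simp_all add: power_int_diff power_int_add)
qed

section \<open>The braiding commutes with \<open>E\<close>, is even and is invertible\<close>

definition E_pair :: "weight \<Rightarrow> weight \<Rightarrow> cq^(basis \<times> basis)^(basis \<times> basis)" where
  "E_pair l m = (\<chi> y x. tensor_E [(Up, l), (Up, m)] [fst y, snd y] [fst x, snd x])"

lemma pair_all: "(\<forall>x. P x) \<longleftrightarrow> P (V0,V0) \<and> P (V0,V1) \<and> P (V1,V0) \<and> P (V1,V1)"
  by (metis basis.exhaust surj_pair)


lemma pairing_neg_one: "pairing (-1, -1) l = - pairing (1, 1) l"
  by (simp add: pairing_def)

lemma pairing_minus_alpha: "pairing (1, 1) (l - \<alpha>) = pairing (1, 1) l"
  by (simp add: pairing_def \<alpha>_def)

lemmas pair_simps = pair_all matrix_matrix_mult_def sum_basis_pair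

lemma Rcheck_E_pair: "E_pair m l ** Rcheck (L l) (L m) = Rcheck (L l) (L m) ** E_pair l m"
proof -
  \<comment> \<open>By \<open>q_powi_form\<close> every power of \<open>q\<close> that occurs is a
    Laurent monomial in these three nonzero elements.\<close>
  define X a b where "X = q powi form l m" "a = q powi pairing (1, 1) l" "b = q powi pairing (1, 1) m"
  have nz: "X \<noteq> 0" "a \<noteq> 0" "b \<noteq> 0"
    using q_nonzero by (simp_all add: X_a_b_def)
  have qbracket_sign: "(q - inverse q) * ((-1) ^ n * qbracket l) = (-1) ^ n * (a - inverse a)" for n
    unfolding X_a_b_def qbracket_mult[symmetric] by (rule mult.left_commute)
  \<comment> \<open>All sixteen entries are compared. The parities of the two labels fix the signs,
    and what remains are rational identities in \<open>X\<close>, \<open>a\<close>,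
    \<open>b\<close>.\<close>
  show ?thesis
    unfolding vec_eq_iff
    by (simp add: pair_simps E_pair_def Rcheck_nth L_simps qbracket_sign q_powi_form
        power_int_minus pairing_minus_alpha X_a_b_def[symmetric] del: split_paired_All)
      (cases "even (snd l)"; cases "even (snd m)"; simp add: deg_L nz field_simps)
qed

definition sign_pair :: "weight \<Rightarrow> weight \<Rightarrow> cq^(basis \<times> basis)^(basis \<times> basis)" where
  "sign_pair l m = diag (\<lambda>x. tensor_sign [(Up, l), (Up, m)] [fst x, snd x])"

text \<open>The braiding is even: the flip keeps the total parity, and \<open>F \<otimes> E\<close>
  changes the parity of both factors.\<close>

lemma Rcheck_sign_pair:
  "sign_pair m l ** Rcheck (L l) (L m) = Rcheck (L l) (L m) ** sign_pair l m"
  unfolding vec_eq_iff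
  by (simp add: pair_simps sign_pair_def diag_def Rcheck_nth L_simps deg_L del: split_paired_All)

text \<open>\<open>CrossUnder\<close> is defined through \<open>matrix_inv\<close>, a choice that is
  characterised only when an inverse exists.\<close>

lemma invertible_Rcheck: "invertible (Rcheck (L l) (L m))"
proof -
  let ?R = "Rcheck (L l) (L m)"
  \<comment> \<open>No other entry can be nonzero. The first four are signed powers of
    \<open>q\<close>, coming from the flip and \<open>Upsilon\<close>; \<open>c4\<close> is the
    contribution of \<open>F \<otimes> E\<close>.\<close>
  define c0 c1 c2 c3 c4 where "c0 = ?R $ (V0, V0) $ (V0, V0)" "c1 = ?R $ (V1, V1) $ (V1, V1)"
    "c2 = ?R $ (V0, V1) $ (V1, V0)" "c3 = ?R $ (V1, V0) $ (V0, V1)" "c4 = ?R $ (V0, V1) $ (V0, V1)"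
  note c_defs = this
  define A :: "cq^(basis \<times> basis)^(basis \<times> basis)" where
    "A = (\<chi> x y. if x = (V0, V0) \<and> y = (V0, V0) then c0
      else if x = (V1, V1) \<and> y = (V1, V1) then c1
      else if x = (V0, V1) \<and> y = (V1, V0) then c2
      else if x = (V1, V0) \<and> y = (V0, V1) then c3
      else if x = (V0, V1) \<and> y = (V0, V1) then c4 else 0)"
  \<comment> \<open>The braiding is triangular up to a permutation of the basis. Inverting its block
    on \<open>(V0, V1)\<close> and \<open>(V1, V0)\<close> divides only by \<open>c2\<close> and
    \<open>c3\<close>.\<close>
  define B :: "cq^(basis \<times> basis)^(basis \<times> basis)" where
    "B = (\<chi> x y. if x = (V0, V0) \<and> y = (V0, V0) then inverse c0
      else if x = (V1, V1) \<and> y = (V1, V1) then inverse c1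
      else if x = (V1, V0) \<and> y = (V0, V1) then inverse c2
      else if x = (V0, V1) \<and> y = (V1, V0) then inverse c3
      else if x = (V1, V0) \<and> y = (V1, V0) then - (inverse c2 * c4 * inverse c3) else 0)"
  have R: "?R = A"
    unfolding vec_eq_iff
    by (simp add: pair_all A_def c_defs del: split_paired_All) (simp add: Rcheck_nth L_simps)
  have "c0 \<noteq> 0" "c1 \<noteq> 0" "c2 \<noteq> 0" "c3 \<noteq> 0"
    using q_nonzero by (simp_all add: c_defs Rcheck_nth L_simps)
  then have "A ** B = mat 1" "B ** A = mat 1"
    unfolding vec_eq_iff by (simp_all add: pair_simps mat_def A_def B_def del: split_paired_All)
  then show ?thesis
    unfolding R invertible_def by blast
qed

lemma invertible_matrix_inv:
  assumes "invertible R"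
  shows "R ** matrix_inv R = mat 1" "matrix_inv R ** R = mat 1"
proof -
  have "R ** matrix_inv R = mat 1 \<and> matrix_inv R ** R = mat 1"
    unfolding matrix_inv_def using assms unfolding invertible_def by (rule someI_ex)
  then show "R ** matrix_inv R = mat 1" "matrix_inv R ** R = mat 1"
    by auto
qed

text \<open>Carries the commutation rules of the over crossing to the under crossing.\<close>

lemma matrix_inv_intertwines:
  fixes R :: "'a::semiring_1^'n^'m"
  assumes "invertible R" "A ** R = R ** B"
  shows "B ** matrix_inv R = matrix_inv R ** A"
proof -
  have "B ** matrix_inv R = matrix_inv R ** (R ** B) ** matrix_inv R"
    using invertible_matrix_inv(2)[OF assms(1)] by (simp add: matrix_mul_assoc)
  also have "\<dots> = matrix_inv R ** A ** (R ** matrix_inv R)"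
    by (simp add: assms(2)[symmetric] matrix_mul_assoc)
  finally show ?thesis
    using invertible_matrix_inv(1)[OF assms(1)] by simp
qed


section \<open>The ribbon element on \<open>L l\<close>, and the operators \<open>K\<close> and its
  inverse obtained from it\<close>

lemma ribbon_v_L: "ribbon_v (L l) = diag (\<lambda>i. q powi (- form (wt (L l) i) (wt (L l) i)) *
    (case i of V0 \<Rightarrow> q powi pairing (1, 1) l | V1 \<Rightarrow> q powi (- pairing (1, 1) l)))"
  \<comment> \<open>\<open>EF\<close> kills \<open>v_1\<close> and multiplies \<open>v_0\<close> by
    the bracket; with \<open>k = pairing (1, 1) l\<close> this turns \<open>q^(-k)\<close> into
    \<open>q^k\<close> on \<open>v_0\<close> only.\<close>
  using q_minus_inverse_nonzero
  unfolding vec_eq_iff ribbon_v_def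
  by (simp add: basis_all matrix_matrix_mult_def sum_basis mat_def diag_def actKinv_def actq_def
      L_simps pairing_neg_one pairing_minus_alpha qbracket_def)

lemma invertible_diag:
  assumes "\<And>i. f i \<noteq> 0"
  shows "invertible (diag f)"
proof -
  have "diag f ** diag (\<lambda>i. inverse (f i)) = mat 1" "diag (\<lambda>i. inverse (f i)) ** diag f = mat 1"
    using assms by (simp_all add: diag_mult) (simp_all add: diag_def mat_def)
  then show ?thesis
    unfolding invertible_def by blast
qed

lemma actK_mult_actKinv: "actK V ** actKinv V = mat 1" "actKinv V ** actK V = mat 1"
  using q_nonzero
  by (simp_all add: actK_def actKinv_def actq_def diag_mult pairing_neg_one power_int_minus)
    (simp_all add: diag_def mat_def)

lemma invertible_ribbon_v: "invertible (ribbon_v (L l))"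
  unfolding ribbon_v_L using q_nonzero by (intro invertible_diag) (auto split: basis.split)

lemma ribbon_u_mult_inv_v: "ribbon_u (L l) ** matrix_inv (ribbon_v (L l)) = actK (L l)"
  unfolding ribbon_u_def
  by (simp add: invertible_matrix_inv[OF invertible_ribbon_v] flip: matrix_mul_assoc)

lemma ribbon_v_mult_inv_u: "ribbon_v (L l) ** matrix_inv (ribbon_u (L l)) = actKinv (L l)"
proof -
  have "invertible (actK (L l))"
    unfolding invertible_def using actK_mult_actKinv by blast
  then have inv: "invertible (ribbon_u (L l))"
    unfolding ribbon_u_def by (intro invertible_mult invertible_ribbon_v)
  have "ribbon_v (L l) = actKinv (L l) ** ribbon_u (L l)"
    by (simp add: ribbon_u_def matrix_mul_assoc actK_mult_actKinv)
  then have "ribbon_v (L l) ** matrix_inv (ribbon_u (L l)) =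
      actKinv (L l) ** (ribbon_u (L l) ** matrix_inv (ribbon_u (L l)))"
    by (simp add: matrix_mul_assoc)
  then show ?thesis
    by (simp add: invertible_matrix_inv[OF inv])
qed

section \<open>Even maps commuting with \<open>E\<close>, and their tensor products\<close>

definition equivariant ::
  "(orientation \<times> weight) list \<Rightarrow> (orientation \<times> weight) list \<Rightarrow> (basis list \<Rightarrow> basis list \<Rightarrow> cq) \<Rightarrow> bool" where
  "equivariant s t A \<longleftrightarrow>
    Kinv_scalar t = Kinv_scalar s \<and>
    (\<forall>ys xs. length ys = length t \<longrightarrow> length xs = length s \<longrightarrow>
      tensor_sign t ys * A ys xs = A ys xs * tensor_sign s xs \<and>
      (\<Sum>zs | length zs = length t. tensor_E t ys zs * A zs xs) =
      (\<Sum>zs | length zs = length s. A ys zs * tensor_E s zs xs))"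

text \<open>The summand \<open>E \<otimes> K^(-1)\<close> passes through by the rule for
  \<open>A\<close> and the equal scalars of \<open>s'\<close> and \<open>t'\<close>; the summand
  \<open>1 \<otimes> E\<close> by the rule for \<open>B\<close> and the evenness of
  \<open>A\<close>. This is why \<open>equivariant\<close> records scalars and signs besides
  \<open>E\<close>.\<close>

lemma equivariant_tensor:
  assumes A: "equivariant s t A" and B: "equivariant s' t' B"
  shows "equivariant (s @ s') (t @ t')
    (\<lambda>ys xs. A (take (length t) ys) (take (length s) xs) * B (drop (length t) ys) (drop (length s) xs))"
    (is "equivariant _ _ ?C")
proof -
  have K: "Kinv_scalar t = Kinv_scalar s" "Kinv_scalar t' = Kinv_scalar s'"
    using A B by (simp_all add: equivariant_def)
  have "tensor_sign (t @ t') ys * ?C ys xs = ?C ys xs * tensor_sign (s @ s') xs \<and>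
      (\<Sum>zs | length zs = length (t @ t'). tensor_E (t @ t') ys zs * ?C zs xs) =
      (\<Sum>zs | length zs = length (s @ s'). ?C ys zs * tensor_E (s @ s') zs xs)"
    if "length ys = length (t @ t')" "length xs = length (s @ s')" for ys xs
  proof -
    define y y' x x' where "y = take (length t) ys" "y' = drop (length t) ys"
      "x = take (length s) xs" "x' = drop (length s) xs"
    note defs = this
    have ys: "ys = y @ y'" "xs = x @ x'"
      by (simp_all add: defs)
    have len: "length y = length t" "length y' = length t'" "length x = length s" "length x' = length s'"
      using that by (simp_all add: defs)
    have signA: "tensor_sign t y * A y x = A y x * tensor_sign s x"
      and EA: "(\<Sum>zs | length zs = length t. tensor_E t y zs * A zs x) =
        (\<Sum>zs | length zs = length s. A y zs * tensor_E s zs x)"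
      using A len by (simp_all add: equivariant_def)
    have signB: "tensor_sign t' y' * B y' x' = B y' x' * tensor_sign s' x'"
      and EB: "(\<Sum>zs | length zs = length t'. tensor_E t' y' zs * B zs x') =
        (\<Sum>zs | length zs = length s'. B y' zs * tensor_E s' zs x')"
      using B len by (simp_all add: equivariant_def)
    have "tensor_sign (t @ t') ys * ?C ys xs = (tensor_sign t y * A y x) * (tensor_sign t' y' * B y' x')"
      by (simp add: ys len tensor_sign_append)
    also have "\<dots> = ?C ys xs * tensor_sign (s @ s') xs"
      by (simp add: ys len tensor_sign_append signA signB)
    finally have sign: "tensor_sign (t @ t') ys * ?C ys xs = ?C ys xs * tensor_sign (s @ s') xs" .
    have "(\<Sum>zs | length zs = length (t @ t'). tensor_E (t @ t') ys zs * ?C zs xs)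
      = (\<Sum>z | length z = length t. \<Sum>z' | length z' = length t'.
          (if y' = z' then tensor_E t y z * A z x * Kinv_scalar t' * B z' x' else 0)
          + (if y = z then tensor_sign t z * A z x * (tensor_E t' y' z' * B z' x') else 0))"
      unfolding length_append sum_lists_append
      by (intro sum.cong refl) (simp add: ys len tensor_E_append algebra_simps)
    also have "\<dots> = (\<Sum>z | length z = length t. tensor_E t y z * A z x) * Kinv_scalar t' * B y' x'
        + tensor_sign t y * A y x * (\<Sum>z' | length z' = length t'. tensor_E t' y' z' * B z' x')"
    proof -
      \<comment> \<open>The condition \<open>y = z\<close> concerns the outer variable alone; once
        it stands outside the inner sum, the outer sum collapses.\<close>
      have "(\<Sum>z | length z = length t. \<Sum>z' | length z' = length t'.
          (if y = z then tensor_sign t z * A z x * (tensor_E t' y' z' * B z' x') else 0))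
        = (\<Sum>z | length z = length t. if y = z then
            tensor_sign t z * A z x * (\<Sum>z' | length z' = length t'. tensor_E t' y' z' * B z' x') else 0)"
        by (intro sum.cong refl) (simp add: sum_distrib_left)
      then show ?thesis
        by (simp add: sum.distrib len finite_lists_length sum_distrib_right)
    qed
    also have "\<dots> = (\<Sum>z | length z = length s. A y z * tensor_E s z x) * Kinv_scalar s' * B y' x'
        + A y x * tensor_sign s x * (\<Sum>z' | length z' = length s'. B y' z' * tensor_E s' z' x')"
      by (simp only: EA EB K signA)
    also have "\<dots> = (\<Sum>z | length z = length s. \<Sum>z' | length z' = length s'.
          (if z' = x' then A y z * tensor_E s z x * Kinv_scalar s' * B y' z' else 0)
          + (if z = x then A y z * tensor_sign s z * (B y' z' * tensor_E s' z' x') else 0))"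
    proof -
      have "(\<Sum>z | length z = length s. \<Sum>z' | length z' = length s'.
          (if z = x then A y z * tensor_sign s z * (B y' z' * tensor_E s' z' x') else 0))
        = (\<Sum>z | length z = length s. if z = x then
            A y z * tensor_sign s z * (\<Sum>z' | length z' = length s'. B y' z' * tensor_E s' z' x') else 0)"
        by (intro sum.cong refl) (simp add: sum_distrib_left)
      then show ?thesis
        by (simp add: sum.distrib len finite_lists_length sum_distrib_right)
    qed
    also have "\<dots> = (\<Sum>zs | length zs = length (s @ s'). ?C ys zs * tensor_E (s @ s') zs xs)"
      unfolding length_append sum_lists_append
      by (intro sum.cong refl) (simp add: ys len tensor_E_append algebra_simps)
    finally show ?thesis
      using sign by blast
  qed
  then show ?thesis
    unfolding equivariant_def by (simp add: Kinv_scalar_append K)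
qed

section \<open>Equivariance of the elementary pieces\<close>

lemma deg_dual_rep: "deg (dual_rep V) i = deg V i"
  by (simp add: deg_def dual_rep_def parity_eq)

text \<open>On the dual, \<open>E\<close> is the signed transpose of \<open>S(E) = - E K\<close>, so
  it sends \<open>v_0^*\<close> to a multiple of \<open>v_1^*\<close>.\<close>

lemma actE_dual_L: "actE (dual_rep (L l)) $ i $ j =
    (if i = V1 \<and> j = V0 then - ((-1) ^ deg (L l) V0 * q powi pairing (1, 1) l) else 0)"
  by (cases i; cases j)
    (simp_all add: dual_rep_def actK_def actq_def mult_diag_nth L_simps pairing_minus_alpha)

lemma wt_L_pairing: "pairing (1, 1) (wt (L l) i) = pairing (1, 1) l"
  by (cases i) (simp_all add: L_simps pairing_minus_alpha)

text \<open>\<open>u v^(-1)\<close> is \<open>K\<close>, a scalar on \<open>L l\<close>, and the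
  sign \<open>(-1)^(|w||w|)\<close> of \<open>ev_hat\<close> is \<open>(-1)^|w|\<close>.\<close>

lemma Q_piece_CapLR:
  "Q_piece (CapLR l) ys [x, y] = (if x = y then (-1) ^ deg (L l) x * q powi pairing (1, 1) l else 0)"
proof -
  have "Q_piece (CapLR l) ys [x, y] =
      (ev_hat (L l) ** tensor_op (L l) (actK (L l)) 0 (mat 1)) $ () $ (x, y)"
    by (simp add: Q_piece_def ribbon_u_mult_inv_v)
  then show ?thesis
    by (cases x; cases y)
      (simp_all add: matrix_matrix_mult_def sum_basis_pair ev_hat_def tensor_op_def mat_def
        actK_def actq_def diag_def wt_L_pairing deg_dual_rep deg_L)
qed

lemma Q_piece_CupLR:
  "Q_piece (CupLR l) [x, y] xs = (if x = y then (-1) ^ deg (L l) x * q powi (- pairing (1, 1) l) else 0)"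
proof -
  have "Q_piece (CupLR l) [x, y] xs =
      (tensor_op (dual_rep (L l)) (mat 1) 0 (actKinv (L l)) ** coev_hat (L l)) $ (x, y) $ ()"
    by (simp add: Q_piece_def ribbon_v_mult_inv_u)
  then show ?thesis
    by (cases x; cases y)
      (simp_all add: matrix_matrix_mult_def sum_basis_pair coev_hat_def tensor_op_def mat_def
        actKinv_def actq_def diag_def pairing_neg_one wt_L_pairing deg_L)
qed

lemma length_1D: "length xs = Suc 0 \<Longrightarrow> \<exists>x. xs = [x]"
  by (simp add: length_Suc_conv)

lemma length_2D: "length xs = Suc (Suc 0) \<Longrightarrow> \<exists>x y. xs = [x, y]"
  by (auto simp: length_Suc_conv)

lemma equivariant_crossing:
  assumes "\<And>ys xs. A ys xs = M $ (ys ! 0, ys ! 1) $ (xs ! 0, xs ! 1)"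
    and E: "E_pair m l ** M = M ** E_pair l m"
    and sign: "sign_pair m l ** M = M ** sign_pair l m"
  shows "equivariant [(Up, l), (Up, m)] [(Up, m), (Up, l)] A"
proof -
  have A: "A [a, b] [c, d] = M $ (a, b) $ (c, d)" for a b c d
    by (simp add: assms(1))
  have "tensor_sign [(Up, m), (Up, l)] [a, b] * A [a, b] [c, d] =
      A [a, b] [c, d] * tensor_sign [(Up, l), (Up, m)] [c, d]" for a b c d
  proof -
    have "(sign_pair m l ** M) $ (a, b) $ (c, d) =
        tensor_sign [(Up, m), (Up, l)] [a, b] * M $ (a, b) $ (c, d)"
      unfolding sign_pair_def
      by (simp add: diag_mult_nth)
    moreover have "(M ** sign_pair l m) $ (a, b) $ (c, d) =
        M $ (a, b) $ (c, d) * tensor_sign [(Up, l), (Up, m)] [c, d]"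
      unfolding sign_pair_def by (simp add: mult_diag_nth)
    ultimately show ?thesis
      by (simp only: A sign)
  qed
  moreover have "(\<Sum>p\<in>UNIV. tensor_E [(Up, m), (Up, l)] [a, b] [fst p, snd p] * A [fst p, snd p] [c, d]) =
      (\<Sum>p\<in>UNIV. A [a, b] [fst p, snd p] * tensor_E [(Up, l), (Up, m)] [fst p, snd p] [c, d])" for a b c d
    using arg_cong[OF E, of "\<lambda>N. N $ (a, b) $ (c, d)"]
    by (simp add: matrix_matrix_mult_def E_pair_def A del: tensor_E.simps)
  ultimately show ?thesis
    unfolding equivariant_def
    by (auto simp: sum_lists_2 simp del: tensor_E.simps tensor_sign.simps dest!: length_2D)
qed

lemma equivariant_strand:
  assumes "\<And>y x. A [y] [x] = (if y = x then 1 else 0)"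
  shows "equivariant [a] [a] A"
  unfolding equivariant_def
  by (auto simp: sum_lists_1 assms if_distrib if_distribR cong: if_cong dest!: length_1D)

text \<open>The target is the trivial representation, where \<open>tensor_E\<close> is 0 and both
  the scalar and the sign are 1.\<close>

lemma equivariant_cap:
  assumes "Kinv_scalar [a, b] = 1"
    and "\<And>x y. A [] [x, y] = A [] [x, y] * tensor_sign [a, b] [x, y]"
    and "\<And>x y. (\<Sum>p\<in>UNIV. A [] [fst p, snd p] * tensor_E [a, b] [fst p, snd p] [x, y]) = 0"
  shows "equivariant [a, b] [] A"
  using assms unfolding equivariant_def
  by (auto simp: sum_lists_2 simp del: tensor_E.simps(2) tensor_sign.simps(2) dest!: length_2D)

lemma equivariant_cup:
  assumes "Kinv_scalar [a, b] = 1"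
    and "\<And>x y. tensor_sign [a, b] [x, y] * A [x, y] [] = A [x, y] []"
    and "\<And>x y. (\<Sum>p\<in>UNIV. tensor_E [a, b] [x, y] [fst p, snd p] * A [fst p, snd p] []) = 0"
  shows "equivariant [] [a, b] A"
  using assms unfolding equivariant_def
  by (auto simp: sum_lists_2 simp del: tensor_E.simps(2) tensor_sign.simps(2) dest!: length_2D)

text \<open>For caps and cups, \<open>L l\<close> and its dual have inverse \<open>K\<close>-scalars
  and equal parities, and the two summands of \<Delta>(E) cancel in the single entry where they do
  not vanish.\<close>

lemma equivariant_piece: "equivariant (piece_source p) (piece_target p) (Q_piece p)"
proof (cases p)
  case (UpStrand l)
  then show ?thesis
    by (simp add: equivariant_strand Q_piece_def mat_def)
next
  case (DownStrand l)
  then show ?thesis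
    by (simp add: equivariant_strand Q_piece_def mat_def)
next
  case (CrossOver l m)
  then show ?thesis
    using equivariant_crossing[of "Q_piece p" "Rcheck (L l) (L m)", OF _ Rcheck_E_pair Rcheck_sign_pair]
    by (simp add: Q_piece_def)
next
  case (CrossUnder l m)
  \<comment> \<open>Here the braiding from \<open>m\<close>, \<open>l\<close> to \<open>l\<close>,
    \<open>m\<close> is inverted, so its rules are used with the labels exchanged.\<close>
  have "E_pair m l ** matrix_inv (Rcheck (L m) (L l)) = matrix_inv (Rcheck (L m) (L l)) ** E_pair l m"
    "sign_pair m l ** matrix_inv (Rcheck (L m) (L l)) = matrix_inv (Rcheck (L m) (L l)) ** sign_pair l m"
    by (intro matrix_inv_intertwines invertible_Rcheck Rcheck_E_pair Rcheck_sign_pair)+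
  then show ?thesis
    using equivariant_crossing[of "Q_piece p" "matrix_inv (Rcheck (L m) (L l))" m l] CrossUnder
    by (simp add: Q_piece_def)
next
  case (CapLR l)
  have "equivariant [(Up, l), (Down, l)] [] (Q_piece (CapLR l))"
  proof (rule equivariant_cap)
    show "(\<Sum>p\<in>UNIV. Q_piece (CapLR l) [] [fst p, snd p] *
        tensor_E [(Up, l), (Down, l)] [fst p, snd p] [x, y]) = 0" for x y
      by (cases x; cases y) (simp_all add: sum_basis_pair Q_piece_CapLR actE_dual_L L_simps deg_L)
  qed (auto simp: Q_piece_CapLR deg_dual_rep q_nonzero power_int_minus simp flip: power_add)
  then show ?thesis
    using CapLR by simp
next
  case (CapRL l)
  have Q: "Q_piece (CapRL l) [] [x, y] = (if x = y then 1 else 0)" for x y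
    by (simp add: Q_piece_def ev_def)
  have "equivariant [(Down, l), (Up, l)] [] (Q_piece (CapRL l))"
  proof (rule equivariant_cap)
    show "(\<Sum>p\<in>UNIV. Q_piece (CapRL l) [] [fst p, snd p] *
        tensor_E [(Down, l), (Up, l)] [fst p, snd p] [x, y]) = 0" for x y
      using q_nonzero
      by (cases x; cases y) (simp_all add: sum_basis_pair Q actE_dual_L L_simps deg_L deg_dual_rep power_int_minus)
  qed (auto simp: Q deg_dual_rep q_nonzero power_int_minus simp flip: power_add)
  then show ?thesis
    using CapRL by simp
next
  case (CupLR l)
  have "equivariant [] [(Down, l), (Up, l)] (Q_piece (CupLR l))"
  proof (rule equivariant_cup)
    show "(\<Sum>p\<in>UNIV. tensor_E [(Down, l), (Up, l)] [x, y] [fst p, snd p] *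
        Q_piece (CupLR l) [fst p, snd p] []) = 0" for x y
      using q_nonzero
      by (cases x; cases y)
        (simp_all add: sum_basis_pair Q_piece_CupLR actE_dual_L L_simps deg_L deg_dual_rep power_int_minus)
  qed (auto simp: Q_piece_CupLR deg_dual_rep q_nonzero power_int_minus simp flip: power_add)
  then show ?thesis
    using CupLR by simp
next
  case (CupRL l)
  have Q: "Q_piece (CupRL l) [x, y] [] = (if x = y then 1 else 0)" for x y
    by (simp add: Q_piece_def coev_def)
  have "equivariant [] [(Up, l), (Down, l)] (Q_piece (CupRL l))"
  proof (rule equivariant_cup)
    show "(\<Sum>p\<in>UNIV. tensor_E [(Up, l), (Down, l)] [x, y] [fst p, snd p] *
        Q_piece (CupRL l) [fst p, snd p] []) = 0" for x y
      using q_nonzero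
      by (cases x; cases y) (simp_all add: sum_basis_pair Q actE_dual_L L_simps deg_L deg_dual_rep power_int_minus)
  qed (auto simp: Q deg_dual_rep q_nonzero power_int_minus simp flip: power_add)
  then show ?thesis
    using CupRL by simp
qed

lemma equivariant_layer: "equivariant (layer_source ps) (layer_target ps) (Q_layer ps)"
proof (induction ps)
  case Nil
  show ?case
    by (simp add: equivariant_def layer_source_def layer_target_def)
next
  case (Cons p ps)
  have "Q_layer (p # ps) = (\<lambda>ys xs.
      Q_piece p (take (length (piece_target p)) ys) (take (length (piece_source p)) xs) *
      Q_layer ps (drop (length (piece_target p)) ys) (drop (length (piece_source p)) xs))"
    by (simp add: fun_eq_iff Let_def)
  then show ?case
    using equivariant_tensor[OF equivariant_piece Cons.IH]
    by (simp add: layer_source_def layer_target_def)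
qed

section \<open>Functionals vanishing on the image of \<open>E\<close>\<close>

definition E_invariant :: "(basis list \<Rightarrow> cq) \<Rightarrow> (orientation \<times> weight) list \<Rightarrow> bool" where
  "E_invariant f s \<longleftrightarrow> (\<forall>xs. length xs = length s \<longrightarrow>
    (\<Sum>zs | length zs = length s. f zs * tensor_E s zs xs) = 0)"

text \<open>With \<open>A\<close> the map of the layer,
  \<open>f \<circ> A \<circ> E = f \<circ> E \<circ> A = 0\<close>.\<close>

lemma E_invariant_layer:
  assumes f: "E_invariant f (layer_target ps)"
  shows "E_invariant (\<lambda>xs. \<Sum>zs | length zs = length (layer_target ps). f zs * Q_layer ps zs xs)
    (layer_source ps)"
  unfolding E_invariant_def
proof (intro allI impI)
  fix xs :: "basis list"
  assume xs: "length xs = length (layer_source ps)"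
  let ?S = "{zs :: basis list. length zs = length (layer_source ps)}"
  let ?T = "{zs :: basis list. length zs = length (layer_target ps)}"
  let ?E = "tensor_E (layer_source ps)" and ?E' = "tensor_E (layer_target ps)"
  have "(\<Sum>zs\<in>?S. (\<Sum>ws\<in>?T. f ws * Q_layer ps ws zs) * ?E zs xs)
      = (\<Sum>ws\<in>?T. f ws * (\<Sum>zs\<in>?S. Q_layer ps ws zs * ?E zs xs))"
    unfolding sum_distrib_left sum_distrib_right by (subst sum.swap) (simp add: mult.assoc)
  also have "\<dots> = (\<Sum>ws\<in>?T. f ws * (\<Sum>zs\<in>?T. ?E' ws zs * Q_layer ps zs xs))"
    using equivariant_layer[of ps] xs by (intro sum.cong refl) (simp add: equivariant_def)
  also have "\<dots> = (\<Sum>zs\<in>?T. (\<Sum>ws\<in>?T. f ws * ?E' ws zs) * Q_layer ps zs xs)"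
    unfolding sum_distrib_left sum_distrib_right by (subst sum.swap) (simp add: mult.assoc)
  also have "\<dots> = 0"
    using f by (simp add: E_invariant_def)
  finally show "(\<Sum>zs\<in>?S. (\<Sum>ws\<in>?T. f ws * Q_layer ps ws zs) * ?E zs xs) = 0" .
qed

text \<open>The induction starts above the last layer, at the empty boundary, where
  \<open>tensor_E\<close> is 0.\<close>

lemma E_invariant_tangle: "is_tangle s D [] \<Longrightarrow> E_invariant (Q D []) s"
proof (induction D arbitrary: s)
  case Nil
  then show ?case
    by (simp add: E_invariant_def)
next
  case (Cons ps D)
  then have "E_invariant (Q D []) (layer_target ps)" "s = layer_source ps"
    by auto
  then show ?case
    using E_invariant_layer by auto
qed

section \<open>Identity strands, used to separate a cup from the rest of its layer\<close>

fun strand :: "orientation \<times> 'l \<Rightarrow> 'l piece" where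
  "strand (Up, l) = UpStrand l"
| "strand (Down, l) = DownStrand l"

lemma strand_boundary: "piece_source (strand a) = [a]" "piece_target (strand a) = [a]"
  by (cases a rule: strand.cases; simp)+

lemma Q_piece_strand: "Q_piece (strand a) [y] [x] = (if y = x then 1 else 0)"
  by (cases a rule: strand.cases) (simp_all add: Q_piece_def mat_def)

lemma layer_boundary_strands:
  "layer_source (map strand t @ ps) = t @ layer_source ps"
  "layer_target (map strand t @ ps) = t @ layer_target ps"
  by (induction t) (simp_all add: layer_source_def layer_target_def strand_boundary)

lemma Q_layer_strands:
  assumes "length ys = length t" "length xs = length t"
  shows "Q_layer (map strand t @ ps) (ys @ ys') (xs @ xs') = (if ys = xs then Q_layer ps ys' xs' else 0)"
  using assms
proof (induction t arbitrary: ys xs)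
  case Nil
  then show ?case by simp
next
  case (Cons a t)
  obtain y ys1 where y: "ys = y # ys1" "length ys1 = length t"
    using Cons.prems by (cases ys) auto
  obtain x xs1 where x: "xs = x # xs1" "length xs1 = length t"
    using Cons.prems by (cases xs) auto
  show ?case
    using Cons.IH[OF y(2) x(2)] by (simp add: x y strand_boundary Q_piece_strand)
qed

text \<open>The preimage is a multiple of \<open>v\<^sub>0\<^sup>* \<otimes> v\<^sub>1\<close>, respectively of \<open>v\<^sub>1 \<otimes> v\<^sub>0\<^sup>*\<close>.\<close>

lemma cup_in_image_E:
  assumes "piece_source p = []"
  obtains xs c where "length xs = length (piece_target p)"
    "\<And>ys. length ys = length (piece_target p) \<Longrightarrow> Q_piece p ys [] = tensor_E (piece_target p) ys xs * c"
proof (cases p)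
  case (CupLR l)
  \<comment> \<open>The power of \<open>q\<close> is the scalar of \<open>K^(-1)\<close> in the
    definition of this cup.\<close>
  have "Q_piece p [x, y] [] = tensor_E (piece_target p) [x, y] [V0, V1] * q powi (- pairing (1, 1) l)"
    for x y
    using CupLR q_nonzero
    by (cases x; cases y) (simp_all add: Q_piece_CupLR actE_dual_L L_simps deg_L deg_dual_rep power_int_minus)
  then show thesis
    using CupLR by (intro that[of "[V0, V1]" "q powi (- pairing (1, 1) l)"]) (auto simp: length_Suc_conv)
next
  case (CupRL l)
  \<comment> \<open>The power of \<open>q\<close> cancels the scalar of \<open>K^(-1)\<close> on the
    dual factor in one summand of \<Delta>(E), and the \<open>K\<close> from \<open>S(E)\<close> in
    the other.\<close>
  have "Q_piece p [x, y] [] = tensor_E (piece_target p) [x, y] [V1, V0] * q powi (- pairing (1, 1) l)"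
    for x y
    using CupRL q_nonzero
    by (cases x; cases y)
      (simp_all add: Q_piece_def coev_def actE_dual_L L_simps deg_L deg_dual_rep power_int_minus)
  then show thesis
    using CupRL by (intro that[of "[V1, V0]" "q powi (- pairing (1, 1) l)"]) (auto simp: length_Suc_conv)
qed (use assms in simp_all)

text \<open>Lifting \<open>ps\<close> above the cup \<open>p\<close> leaves an \<open>E\<close>-invariant functional on the target of \<open>p\<close> alone.\<close>

lemma Q_layer_cup:
  assumes f: "E_invariant f (layer_target (p # ps))" and source: "layer_source (p # ps) = []"
  shows "(\<Sum>zs | length zs = length (layer_target (p # ps)). f zs * Q_layer (p # ps) zs []) = 0"
proof -
  define t where "t = piece_target p"
  have sp: "piece_source p = []" and sps: "layer_source ps = []"
    using source by (simp_all add: layer_source_def)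
  have tgt: "layer_target (p # ps) = t @ layer_target ps"
    by (simp add: layer_target_def t_def)
  define g where "g = (\<lambda>xs. \<Sum>zs | length zs = length (t @ layer_target ps).
    f zs * Q_layer (map strand t @ ps) zs xs)"
  \<comment> \<open>The pieces of \<open>ps\<close> have no source points, so the lifted layer
    starts at exactly \<open>t\<close>.\<close>
  have g: "E_invariant g t"
    using E_invariant_layer[of f "map strand t @ ps"] f
    by (simp add: layer_boundary_strands sps tgt g_def)
  have g_eq: "g xs = (\<Sum>zs | length zs = length (layer_target ps). f (xs @ zs) * Q_layer ps zs [])"
    if xs: "length xs = length t" for xs
  proof -
    \<comment> \<open>Writing \<open>xs @ []\<close> gives the source the shape that
      \<open>Q_layer_strands\<close> expects.\<close>
    have "g xs = (\<Sum>ys | length ys = length t. \<Sum>zs | length zs = length (layer_target ps).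
        f (ys @ zs) * Q_layer (map strand t @ ps) (ys @ zs) (xs @ []))"
      unfolding g_def length_append sum_lists_append by simp
    also have "\<dots> = (\<Sum>ys | length ys = length t. if ys = xs then
        (\<Sum>zs | length zs = length (layer_target ps). f (ys @ zs) * Q_layer ps zs []) else 0)"
      by (intro sum.cong refl) (simp add: Q_layer_strands xs del: append_Nil2)
    finally show ?thesis
      by (simp add: finite_lists_length xs)
  qed
  obtain xs c where xs: "length xs = length t"
    and cup: "\<And>ys. length ys = length t \<Longrightarrow> Q_piece p ys [] = tensor_E t ys xs * c"
    using cup_in_image_E[OF sp] unfolding t_def by blast
  have "(\<Sum>zs | length zs = length (layer_target (p # ps)). f zs * Q_layer (p # ps) zs [])
      = (\<Sum>ys | length ys = length t. \<Sum>zs | length zs = length (layer_target ps).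
          f (ys @ zs) * (Q_piece p ys [] * Q_layer ps zs []))"
    unfolding tgt length_append sum_lists_append
    by (intro sum.cong refl) (simp add: sp flip: t_def)
  also have "\<dots> = (\<Sum>ys | length ys = length t. g ys * Q_piece p ys [])"
    by (intro sum.cong refl) (simp add: g_eq sum_distrib_left sum_distrib_right mult_ac)
  \<comment> \<open>Replacing the cup by its preimage under \<open>E\<close> exhibits the value as a
    multiple of \<open>g \<circ> E\<close>.\<close>
  also have "\<dots> = (\<Sum>ys | length ys = length t. g ys * tensor_E t ys xs) * c"
    by (simp add: sum_distrib_right cup mult.assoc)
  also have "\<dots> = 0"
    using g xs by (simp add: E_invariant_def)
  finally show ?thesis .
qed

theorem proposition4p4:
  fixes D :: "weight diagram"
  assumes "is_link D"
    and "pieces D \<noteq> {}"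
    and "labels D \<subseteq> P'"
  shows "Q_link D = 0"
proof -
  have "is_tangle [] D [] \<Longrightarrow> pieces D \<noteq> {} \<Longrightarrow> Q D [] [] = 0"
  proof (induction D)
    \<comment> \<open>The empty diagram has value 1; it is excluded by the assumption on
      \<open>pieces\<close>.\<close>
    case Nil
    then show ?case
      by (simp add: pieces_def)
  next
    case (Cons ps D)
    show ?case
    proof (cases ps)
      \<comment> \<open>A layer without pieces is the identity of the empty boundary and is
        skipped.\<close>
      case Nil
      then show ?thesis
        using Cons by (simp add: layer_source_def layer_target_def pieces_def)
    next
      \<comment> \<open>The source of the layer is empty, so its first piece \<open>p\<close> is a
        cup.\<close>
      case (Cons p ps')
      then show ?thesis
        using Q_layer_cup[of "Q D []" p ps'] E_invariant_tangle[of "layer_target ps" D] Cons.prems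
        by simp
    qed
  qed
  then show ?thesis
    using assms by (simp add: is_link_def Q_link_def)
qed

end
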